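(* There exists an adaptive deterministic algorithm that solves the Graph Reconstruction problem with a CC oracle using $\mathcal{O}(k^3\log n)$ CC queries when the treewidth $k$ of the hidden graph is known, where $n$ is the number of vertices.
   Context: Graph Reconstruction (GR): an unknown ("hidden") simple undirected graph $G=(V,E)$ on a known vertex set $V$ with $|V|=n$ is to be determined, i.e. the algorithm must output $E$. A CC oracle, on query $S\subseteq V$, returns the partition of $S$ into the vertex sets of the connected components of the induced subgraph $G[S]$; complexity is the number of queries. An adaptive algorithm may choose queries depending on earlier answers; a deterministic algorithm must always output the hidden graph. *)

theory Defs
  imports Complex_Main
begin

text \<open>A graph is given by its vertex set and its set of edges, an edge being the
  two-element set of its ends.\<close>

definition simple_graph :: "'a set \<Rightarrow> 'a set set \<Rightarrow> bool" where
  "simple_graph V E \<longleftrightarrow> finite V \<and> (\<forall>e\<in>E. e \<subseteq> V \<and> card e = 2)"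

definition induced_edges :: "'a set set \<Rightarrow> 'a set \<Rightarrow> 'a set set" where
  "induced_edges E S = {e \<in> E. e \<subseteq> S}"

definition adj_rel :: "'a set set \<Rightarrow> ('a \<times> 'a) set" where
  "adj_rel E = {(u, v). {u, v} \<in> E}"

definition conn_rel :: "'a set \<Rightarrow> 'a set set \<Rightarrow> ('a \<times> 'a) set" where
  "conn_rel V E = {(u, v). u \<in> V \<and> v \<in> V \<and> (u, v) \<in> (adj_rel E)\<^sup>*}"

definition graph_components :: "'a set \<Rightarrow> 'a set set \<Rightarrow> 'a set set" where
  "graph_components V E = V // conn_rel V E"

definition graph_connected :: "'a set \<Rightarrow> 'a set set \<Rightarrow> bool" where
  "graph_connected V E \<longleftrightarrow> V \<noteq> {} \<and> (\<forall>u\<in>V. \<forall>v\<in>V. (u, v) \<in> conn_rel V E)"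

definition graph_cycle :: "'a set set \<Rightarrow> 'a list \<Rightarrow> bool" where
  "graph_cycle E p \<longleftrightarrow> 3 \<le> length p \<and> distinct p \<and>
     (\<forall>i<length p. {p ! i, p ! (Suc i mod length p)} \<in> E)"

definition is_tree :: "'a set \<Rightarrow> 'a set set \<Rightarrow> bool" where
  "is_tree V E \<longleftrightarrow> simple_graph V E \<and> graph_connected V E \<and> (\<nexists>p. graph_cycle E p)"

text \<open>\<open>B i\<close> is the bag of the node \<open>i\<close> of the tree with nodes \<open>I\<close> and edges \<open>F\<close>.\<close>

definition tree_decomposition ::
  "'a set \<Rightarrow> 'a set set \<Rightarrow> 'i set \<Rightarrow> 'i set set \<Rightarrow> ('i \<Rightarrow> 'a set) \<Rightarrow> bool" where
  "tree_decomposition V E I F B \<longleftrightarrow>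
     is_tree I F \<and>
     (\<Union>i\<in>I. B i) = V \<and>
     (\<forall>e\<in>E. \<exists>i\<in>I. e \<subseteq> B i) \<and>
     (\<forall>v\<in>V. graph_connected {i\<in>I. v \<in> B i} (induced_edges F {i\<in>I. v \<in> B i}))"

definition decomposition_width :: "'i set \<Rightarrow> ('i \<Rightarrow> 'a set) \<Rightarrow> nat" where
  "decomposition_width I B = Max ((\<lambda>i. card (B i)) ` I) - 1"

text \<open>Trees are finite, so natural numbers suffice as tree nodes. The subtraction in the
  width truncates only if \<open>V\<close> is empty, where this gives treewidth \<open>0\<close> instead of the
  customary \<open>-1\<close>.\<close>

definition treewidth :: "'a set \<Rightarrow> 'a set set \<Rightarrow> nat" where
  "treewidth V E =
     (LEAST w. \<exists>(I :: nat set) F B. tree_decomposition V E I F B \<and> decomposition_width I B = w)"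

definition cc_oracle :: "'a set set \<Rightarrow> 'a set \<Rightarrow> 'a set set" where
  "cc_oracle E S = graph_components S (induced_edges E S)"

text \<open>An adaptive deterministic algorithm (for a fixed input) is a decision tree: it either
  stops with an edge set, or asks a vertex set and continues depending on the answer, which
  is a partition. As the trees are inductively generated, every run terminates.\<close>

datatype 'a query_alg =
    Output "'a set set"
  | Query "'a set" "'a set set \<Rightarrow> 'a query_alg"

primrec run_output :: "('a set \<Rightarrow> 'a set set) \<Rightarrow> 'a query_alg \<Rightarrow> 'a set set" where
  "run_output orc (Output F) = F"
| "run_output orc (Query S next) = run_output orc (next (orc S))"

primrec run_queries :: "('a set \<Rightarrow> 'a set set) \<Rightarrow> 'a query_alg \<Rightarrow> 'a set list" where
  "run_queries orc (Output F) = []"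
| "run_queries orc (Query S next) = S # run_queries orc (next (orc S))"

end

theory Submission
  imports Defs "HOL-Library.FuncSet"
begin

text \<open>Let \<open>H'\<close> join all pairs of vertices with a common bag in an optimal tree decomposition.
  Two vertices without a common bag are separated by at most \<open>k\<close> others, so a family of
  \<open>O(k\<^sup>3 log n)\<close> sets, in which for all \<open>u\<close>, \<open>v\<close> and every set \<open>T\<close> of at most \<open>k\<close> other
  vertices some member contains \<open>u\<close> and \<open>v\<close> and misses \<open>T\<close>, separates all pairs outside \<open>H'\<close>.
  The pairs not separated form a graph \<open>H\<close> between \<open>G\<close> and \<open>H'\<close>. As \<open>H'\<close> is chordal with cliques
  of size at most \<open>k + 1\<close>, it has a proper colouring with \<open>k + 1\<close> colours, and any two colour
  classes induce a forest. Querying the unions of two colour classes of \<open>H\<close> therefore separates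
  the ends of all edges of \<open>H\<close> that are not in \<open>G\<close>, and the answer is the set of all pairs that
  were never separated.\<close>

section \<open>Walks\<close>

lemma sym_adj_rel: "sym (adj_rel E)"
  by (auto simp: sym_def adj_rel_def insert_commute)

lemma adj_rel_rtrancl_commute: "(u, v) \<in> (adj_rel E)\<^sup>* \<longleftrightarrow> (v, u) \<in> (adj_rel E)\<^sup>*"
  using sym_adj_rel sym_rtrancl by (metis symE)

lemma adj_rel_rtrancl_mono: "E \<subseteq> F \<Longrightarrow> (u, v) \<in> (adj_rel E)\<^sup>* \<Longrightarrow> (u, v) \<in> (adj_rel F)\<^sup>*"
  by (rule set_mp[OF rtrancl_mono]) (auto simp: adj_rel_def)

lemma induced_edges_subset: "e \<in> induced_edges E S \<Longrightarrow> e \<subseteq> S"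
  by (simp add: induced_edges_def)

text \<open>Walk surgery: each passage \<open>a\<close>, \<open>w\<close>, \<open>b\<close> of the
  walk is replaced by a \<open>Q\<close>-walk from \<open>a\<close> to \<open>b\<close>. It serves
  to remove a last-added vertex from an elimination graph and a leaf from a tree.\<close>

lemma rtrancl_bypass:
  assumes "(x, y) \<in> R\<^sup>*" "x \<noteq> w" "y \<noteq> w"
    and through: "\<And>a b. (a, w) \<in> R \<Longrightarrow> (w, b) \<in> R \<Longrightarrow> a \<noteq> w \<Longrightarrow> b \<noteq> w \<Longrightarrow> (a, b) \<in> Q\<^sup>*"
    and avoid: "\<And>a b. (a, b) \<in> R \<Longrightarrow> a \<noteq> w \<Longrightarrow> b \<noteq> w \<Longrightarrow> (a, b) \<in> Q\<^sup>*"
  shows "(x, y) \<in> Q\<^sup>*"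
proof -
  \<comment> \<open>While the walk stands at \<open>w\<close>, the invariant remembers a vertex
    \<open>a\<close> from which it stepped there, so that the detour can start at
    \<open>a\<close>.\<close>
  have "(y \<noteq> w \<longrightarrow> (x, y) \<in> Q\<^sup>*) \<and> (y = w \<longrightarrow> (\<exists>a. a \<noteq> w \<and> (x, a) \<in> Q\<^sup>* \<and> (a, w) \<in> R))"
    using assms(1)
  proof (induction rule: rtrancl_induct)
    case base
    then show ?case using assms(2) by simp
  next
    case (step y z)
    show ?case
    proof (cases "y = w")
      case True
      then obtain a where "a \<noteq> w" "(x, a) \<in> Q\<^sup>*" "(a, w) \<in> R" using step.IH by blast
      then show ?thesis using through[of a z] step.hyps(2) True by (meson rtrancl_trans)
    next
      case False
      then show ?thesis using avoid[of y z] step.hyps(2) step.IH by (meson rtrancl_trans)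
    qed
  qed
  then show ?thesis using assms(3) by blast
qed

lemma isolated_not_rtrancl:
  assumes "\<And>y. {u, y} \<notin> E" "u \<noteq> v"
  shows "(u, v) \<notin> (adj_rel E)\<^sup>*"
  using assms by (auto simp: adj_rel_def elim: converse_rtranclE)

section \<open>Perfect elimination orderings\<close>

text \<open>The chordal graphs with cliques of size at most \<open>k + 1\<close>, built up in the
  reverse of a perfect elimination ordering. \<open>V\<close> is carried along because
  \<open>H\<close> does not show isolated vertices.\<close>

inductive elimination_graph :: "nat \<Rightarrow> 'a set \<Rightarrow> 'a set set \<Rightarrow> bool" for k where
  empty: "elimination_graph k {} {}"
| insert: "elimination_graph k V H \<Longrightarrow> w \<notin> V \<Longrightarrow> N \<subseteq> V \<Longrightarrow> card N \<le> k \<Longrightarrow>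
    (\<And>x y. x \<in> N \<Longrightarrow> y \<in> N \<Longrightarrow> x \<noteq> y \<Longrightarrow> {x, y} \<in> H) \<Longrightarrow>
    elimination_graph k (insert w V) (H \<union> (\<lambda>x. {w, x}) ` N)"

lemma elimination_graph_finite: "elimination_graph k V H \<Longrightarrow> finite V"
  by (induction rule: elimination_graph.induct) auto

lemma elimination_graph_edges: "elimination_graph k V H \<Longrightarrow> e \<in> H \<Longrightarrow> e \<subseteq> V \<and> card e = 2"
  by (induction arbitrary: e rule: elimination_graph.induct) (auto simp: card_insert_if)

lemma elimination_graph_0: "elimination_graph 0 V H \<Longrightarrow> H = {}"
proof (induction rule: elimination_graph.induct)
  case (insert V H w N)
  \<comment> \<open>An infinite \<open>N\<close> would also have \<open>card N = 0\<close>, hence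
    the appeal to finiteness of \<open>V\<close>.\<close>
  have "N = {}"
    using finite_subset[OF insert.hyps(3) elimination_graph_finite[OF insert.hyps(1)]] insert.hyps(4)
    by simp
  then show ?case using insert by simp
qed simp

text \<open>If one of the two vertices is the newest vertex \<open>w\<close>, its older neighbours
  \<open>N\<close> isolate it. Otherwise a separator found before \<open>w\<close> was added still
  works, because a walk through \<open>w\<close> can be shortcut inside the clique
  \<open>N\<close>.\<close>

lemma elimination_graph_separator:
  assumes "elimination_graph k V H" "u \<in> V" "v \<in> V" "u \<noteq> v" "{u, v} \<notin> H"
  shows "\<exists>T. T \<subseteq> V - {u, v} \<and> card T \<le> k \<and> (u, v) \<notin> (adj_rel (induced_edges H (V - T)))\<^sup>*"
  using assms
proof (induction arbitrary: u v rule: elimination_graph.induct)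
  case empty
  then show ?case by simp
next
  case (insert V H w N)
  let ?H = "H \<union> (\<lambda>x. {w, x}) ` N" and ?V = "insert w V"
  have HV: "e \<subseteq> V" if "e \<in> H" for e using elimination_graph_edges insert.hyps(1) that by blast
  have sep: "(w, x) \<notin> (adj_rel (induced_edges ?H (?V - N)))\<^sup>*" if "x \<noteq> w" for x
    using that insert.hyps(2,3) HV
    by (intro isolated_not_rtrancl) (auto simp: induced_edges_def doubleton_eq_iff)
  consider "u = w" | "v = w" | "u \<noteq> w" "v \<noteq> w" by blast
  then show ?case
  proof cases
    case 1
    then show ?thesis using insert.hyps insert.prems sep
      by (intro exI[of _ N]) auto
  next
    case 2
    then have "(u, v) \<notin> (adj_rel (induced_edges ?H (?V - N)))\<^sup>*"
      using sep adj_rel_rtrancl_commute insert.prems by metis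
    then show ?thesis using 2 insert.hyps insert.prems
      by (intro exI[of _ N]) (auto simp: insert_commute)
  next
    case 3
    then obtain T where T: "T \<subseteq> V - {u, v}" "card T \<le> k"
      "(u, v) \<notin> (adj_rel (induced_edges H (V - T)))\<^sup>*"
      using insert.IH[of u v] insert.prems by auto
    have "(u, v) \<in> (adj_rel (induced_edges H (V - T)))\<^sup>*"
      if "(u, v) \<in> (adj_rel (induced_edges ?H (?V - T)))\<^sup>*"
      using that 3
    proof (rule rtrancl_bypass)
      fix a b
      assume "(a, w) \<in> adj_rel (induced_edges ?H (?V - T))"
        "(w, b) \<in> adj_rel (induced_edges ?H (?V - T))" "a \<noteq> w" "b \<noteq> w"
      then have "a \<in> N - T" "b \<in> N - T"
        using HV insert.hyps(2) by (auto simp: adj_rel_def induced_edges_def doubleton_eq_iff)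
      \<comment> \<open>Neighbours of \<open>w\<close> outside \<open>T\<close> lie in the clique
        \<open>N\<close>, so the passage through \<open>w\<close> shrinks to an edge or to
        nothing.\<close>
      then have "a = b \<or> (a, b) \<in> adj_rel (induced_edges H (V - T))"
        using insert.hyps(3,5) by (auto simp: adj_rel_def induced_edges_def)
      then show "(a, b) \<in> (adj_rel (induced_edges H (V - T)))\<^sup>*" by auto
    next
      fix a b
      assume "(a, b) \<in> adj_rel (induced_edges ?H (?V - T))" "a \<noteq> w" "b \<noteq> w"
      then show "(a, b) \<in> (adj_rel (induced_edges H (V - T)))\<^sup>*"
        by (intro r_into_rtrancl) (auto simp: adj_rel_def induced_edges_def doubleton_eq_iff)
    qed
    then show ?thesis using T by (intro exI[of _ T]) auto
  qed
qed

text \<open>The second conjunct says that every edge is a bridge of the graph induced by the colour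
  classes of its ends, i.e. that these graphs are forests.\<close>

definition acyclic_colouring :: "'a set \<Rightarrow> 'a set set \<Rightarrow> ('a \<Rightarrow> nat) \<Rightarrow> bool" where
  "acyclic_colouring V H c \<longleftrightarrow> (\<forall>u v. {u, v} \<in> H \<longrightarrow> c u \<noteq> c v \<and>
    (u, v) \<notin> (adj_rel (induced_edges (H - {{u, v}}) {x \<in> V. c x \<in> {c u, c v}}))\<^sup>*)"

lemma acyclic_colouringD:
  assumes "acyclic_colouring V H c" "{u, v} \<in> H"
  shows "c u \<noteq> c v"
    and "(u, v) \<notin> (adj_rel (induced_edges (H - {{u, v}}) {x \<in> V. c x \<in> {c u, c v}}))\<^sup>*"
  using assms(1)[unfolded acyclic_colouring_def, rule_format, OF assms(2)]
  by simp_all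

text \<open>Greedy colouring: \<open>N\<close> uses at most \<open>k\<close> of the
  \<open>k + 1\<close> colours, so one is free for \<open>w\<close>. The vertices of the clique
  \<open>N\<close> have distinct colours, so in the union of two colour classes \<open>w\<close> has
  at most one neighbour and closes no cycle.\<close>

lemma elimination_graph_acyclic_colouring:
  assumes "elimination_graph k V H"
  shows "\<exists>c. c ` V \<subseteq> {..k} \<and> acyclic_colouring V H c"
  using assms
proof (induction rule: elimination_graph.induct)
  case empty
  then show ?case by (simp add: acyclic_colouring_def)
next
  case (insert V H w N)
  obtain c where c: "c ` V \<subseteq> {..k}" and acyc: "acyclic_colouring V H c"
    using insert.IH by blast
  note proper = acyclic_colouringD(1)[OF acyc] and bridge = acyclic_colouringD(2)[OF acyc]
  have "finite N" using insert.hyps elimination_graph_finite finite_subset by metis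
  then have "card (c ` N) < card {..k}" using card_image_le[of N c] insert.hyps(4) by simp
  then have "\<not> {..k} \<subseteq> c ` N" using \<open>finite N\<close> card_mono by (metis finite_imageI not_less)
  then obtain i where i: "i \<le> k" "i \<notin> c ` N" by auto
  define d where "d = c(w := i)"
  let ?H = "H \<union> (\<lambda>x. {w, x}) ` N" and ?V = "insert w V"
  let ?G = "\<lambda>u v. induced_edges (?H - {{u, v}}) {x \<in> ?V. d x \<in> {d u, d v}}"
  have HV: "e \<subseteq> V" if "e \<in> H" for e using elimination_graph_edges insert.hyps(1) that by blast
  have new_edge: "x \<in> N" if "{w, x} \<in> ?H" for x
    using that HV[of "{w, x}"] insert.hyps(2) by (auto simp: doubleton_eq_iff)
  have d: "d w = i" "\<And>x. x \<in> V \<Longrightarrow> d x = c x" using insert.hyps(2) by (auto simp: d_def)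
  have N: "x \<in> V" "d x \<noteq> i" if "x \<in> N" for x using that i insert.hyps(3) d(2)[of x] by auto
  have new: "(w, x) \<notin> (adj_rel (?G w x))\<^sup>*" if x: "x \<in> N" for x
  proof (rule isolated_not_rtrancl)
    show "w \<noteq> x" using x insert.hyps by auto
    fix y
    show "{w, y} \<notin> ?G w x"
    proof
      assume y: "{w, y} \<in> ?G w x"
      then have "y \<in> N" "y \<noteq> x" "d y \<in> {d w, d x}"
        using HV insert.hyps(2) by (auto simp: induced_edges_def doubleton_eq_iff)
      \<comment> \<open>No vertex of \<open>N\<close> has colour \<open>i\<close>, so
        \<open>y\<close> has the colour of \<open>x\<close>; but both lie in the properly coloured
        clique \<open>N\<close>.\<close>
      then show False using x N d proper[of x y] insert.hyps(5)[of x y] by auto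
    qed
  qed
  have "d u \<noteq> d v \<and> (u, v) \<notin> (adj_rel (?G u v))\<^sup>*" if uv: "{u, v} \<in> ?H" for u v
  proof -
    consider "{u, v} \<in> H" | "u = w" "v \<in> N" | "v = w" "u \<in> N"
      using uv by (auto simp: doubleton_eq_iff)
    then show ?thesis
    proof cases
      case 1
      then have uvV: "u \<in> V" "v \<in> V" using HV by auto
      then have uvw: "u \<noteq> w" "v \<noteq> w" using insert.hyps(2) by auto
      let ?Q = "adj_rel (induced_edges (H - {{u, v}}) {x \<in> V. c x \<in> {c u, c v}})"
      have "(u, v) \<in> ?Q\<^sup>*" if "(u, v) \<in> (adj_rel (?G u v))\<^sup>*"
        using that uvw
      proof (rule rtrancl_bypass)
        fix a b
        assume "(a, w) \<in> adj_rel (?G u v)" "(w, b) \<in> adj_rel (?G u v)"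
        then have ab: "{w, a} \<in> ?G u v" "{w, b} \<in> ?G u v"
          by (simp_all only: adj_rel_def mem_Collect_eq prod.case insert_commute)
        then have "{w, a} \<in> ?H" "{w, b} \<in> ?H" by (simp_all add: induced_edges_def)
        then have "a \<in> N" "b \<in> N" by (simp_all only: new_edge)
        moreover have "d w \<in> {d u, d v}" "d a \<in> {d u, d v}" "d b \<in> {d u, d v}"
          using ab[THEN induced_edges_subset] by simp_all
        \<comment> \<open>Both ends carry the one colour of \<open>{d u, d v}\<close> that differs
          from \<open>i\<close>.\<close>
        ultimately have "d a = d b" using N(2) d(1) by auto
        then have "a = b"
          using \<open>a \<in> N\<close> \<open>b \<in> N\<close> N(1) d(2) proper[of a b] insert.hyps(5)[of a b] by auto
        then show "(a, b) \<in> ?Q\<^sup>*" by simp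
      next
        fix a b
        assume ab: "(a, b) \<in> adj_rel (?G u v)" "a \<noteq> w" "b \<noteq> w"
        then have "a \<in> V" "b \<in> V" by (auto simp: adj_rel_def induced_edges_def)
        then show "(a, b) \<in> ?Q\<^sup>*"
          using ab uvV d(2)
          by (intro r_into_rtrancl) (auto simp: adj_rel_def induced_edges_def doubleton_eq_iff)
      qed
      then show ?thesis using bridge[OF 1] proper[OF 1] d(2) uvV by auto
    next
      case 2
      then show ?thesis using new[of v] N(2)[of v] d(1) by auto
    next
      case 3
      have "?G w u = ?G u w" by (simp add: insert_commute)
      then show ?thesis
        using new[of u] adj_rel_rtrancl_commute[of w u] N(2)[of u] d(1) 3 by auto
    qed
  qed
  then have "acyclic_colouring ?V ?H d" unfolding acyclic_colouring_def by blast
  moreover have "d ` ?V \<subseteq> {..k}" using c d i by auto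
  ultimately show ?case by blast
qed

text \<open>One set for each ordered pair of the \<open>k + 1\<close> colours of \<open>H'\<close>;
  bridges of a two-coloured part of \<open>H'\<close> remain bridges in the subgraph
  \<open>H\<close>. If such an edge of \<open>H\<close> is absent from the hidden graph, querying
  its set separates its ends.\<close>

lemma elimination_graph_bridge_sets:
  assumes "elimination_graph k V H'" "H \<subseteq> H'"
  shows "\<exists>Ts. length Ts = (k + 1)\<^sup>2 \<and> (\<forall>S\<in>set Ts. S \<subseteq> V) \<and> (\<forall>u v. {u, v} \<in> H \<longrightarrow>
    (\<exists>S\<in>set Ts. u \<in> S \<and> v \<in> S \<and> (u, v) \<notin> (adj_rel (induced_edges (H - {{u, v}}) S))\<^sup>*))"
proof -
  obtain c where c: "c ` V \<subseteq> {..k}" "acyclic_colouring V H' c"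
    using elimination_graph_acyclic_colouring[OF assms(1)] by blast
  define Ts where "Ts = map (\<lambda>(i, j). {x \<in> V. c x \<in> {i, j}}) (List.product [0..<Suc k] [0..<Suc k])"
  have "\<exists>S\<in>set Ts. u \<in> S \<and> v \<in> S \<and> (u, v) \<notin> (adj_rel (induced_edges (H - {{u, v}}) S))\<^sup>*"
    if uv: "{u, v} \<in> H" for u v
  proof -
    let ?S = "{x \<in> V. c x \<in> {c u, c v}}"
    have V: "u \<in> V" "v \<in> V" using elimination_graph_edges[OF assms(1)] uv assms(2) by blast+
    then have "(c u, c v) \<in> set (List.product [0..<Suc k] [0..<Suc k])"
      using c(1) by (auto simp: less_Suc_eq_le simp del: upt_Suc)
    then have "?S \<in> set Ts" unfolding Ts_def by force
    have sub: "induced_edges (H - {{u, v}}) ?S \<subseteq> induced_edges (H' - {{u, v}}) ?S"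
      using assms(2) by (auto simp: induced_edges_def)
    have "(u, v) \<notin> (adj_rel (induced_edges (H - {{u, v}}) ?S))\<^sup>*"
      using acyclic_colouringD(2)[OF c(2) subsetD[OF assms(2) uv]] adj_rel_rtrancl_mono[OF sub]
      by (rule contrapos_nn)
    then show ?thesis using V \<open>?S \<in> set Ts\<close> by (intro bexI[of _ ?S]) simp_all
  qed
  moreover have "length Ts = (k + 1)\<^sup>2" "\<forall>S\<in>set Ts. S \<subseteq> V"
    by (auto simp: Ts_def power2_eq_square)
  ultimately show ?thesis by blast
qed

text \<open>Adds a whole bag: the vertices of \<open>M\<close> enter one at a time, each joined to
  \<open>N\<close> and to those of \<open>M\<close> already present. The size bound
  \<open>k + 1\<close> includes the entering vertex, which leaves at most \<open>k\<close>
  neighbours.\<close>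

lemma elimination_graph_add_clique:
  assumes "elimination_graph k V H" "finite M" "M \<inter> V = {}" "N \<subseteq> V" "card (N \<union> M) \<le> k + 1"
    and "\<And>x y. x \<in> N \<Longrightarrow> y \<in> N \<Longrightarrow> x \<noteq> y \<Longrightarrow> {x, y} \<in> H"
  shows "elimination_graph k (V \<union> M) (H \<union> {{x, y} | x y. x \<in> N \<union> M \<and> y \<in> N \<union> M \<and> x \<noteq> y})"
  using assms(2,3,5)
proof (induction M rule: finite_induct)
  case empty
  then have "H \<union> {{x, y} | x y. x \<in> N \<union> {} \<and> y \<in> N \<union> {} \<and> x \<noteq> y} = H"
    using assms(6) by auto
  then show ?case using assms(1) by simp
next
  case (insert w M)
  let ?K = "\<lambda>M. H \<union> {{x, y} | x y. x \<in> N \<union> M \<and> y \<in> N \<union> M \<and> x \<noteq> y}"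
  have fin: "finite (N \<union> M)"
    using assms(1,4) insert.hyps elimination_graph_finite finite_subset by blast
  have w: "w \<notin> N \<union> M" "w \<notin> V \<union> M" using insert assms(4) by auto
  have card: "card (N \<union> M) \<le> k" using insert.prems(2) fin w by simp
  then have "elimination_graph k (V \<union> M) (?K M)" using insert by simp
  then have "elimination_graph k (insert w (V \<union> M)) (?K M \<union> (\<lambda>x. {w, x}) ` (N \<union> M))"
    using w card assms(4) by (intro elimination_graph.insert) auto
  also have "?K M \<union> (\<lambda>x. {w, x}) ` (N \<union> M) = ?K (insert w M)"
    using w by (auto simp: insert_commute)
  finally show ?case by simp
qed

section \<open>Tree decompositions\<close>

text \<open>The first vertex of a longest path is a leaf: a neighbour off the path would prolong it,
  and one on the path beyond the second vertex would close a cycle.\<close>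

lemma tree_leaf:
  assumes "is_tree I F" "card I \<ge> 2"
  shows "\<exists>l\<in>I. \<exists>j\<in>I. l \<noteq> j \<and> (\<forall>x. {l, x} \<in> F \<longleftrightarrow> x = j)"
proof -
  have simple: "simple_graph I F" and conn: "graph_connected I F" and acyc: "\<nexists>p. graph_cycle F p"
    using assms by (auto simp: is_tree_def)
  have fin: "finite I" using simple by (simp add: simple_graph_def)
  have F: "x \<in> I" "y \<in> I" "x \<noteq> y" if "{x, y} \<in> F" for x y
    using that simple unfolding simple_graph_def by fastforce+
  define P where "P p \<longleftrightarrow> distinct p \<and> set p \<subseteq> I \<and> (\<forall>i. Suc i < length p \<longrightarrow> {p ! i, p ! Suc i} \<in> F)"
    for p
  obtain u v where "u \<in> I" "v \<in> I" "u \<noteq> v"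
    using assms(2) by (metis card_2_iff obtain_subset_with_card_n insert_subset)
  then have "(u, v) \<in> (adj_rel F)\<^sup>*" using conn by (auto simp: graph_connected_def conn_rel_def)
  then obtain y where y: "{u, y} \<in> F"
    using \<open>u \<noteq> v\<close> by (auto simp: adj_rel_def elim: converse_rtranclE)
  then have P2: "P [u, y]" using F[OF y] by (auto simp: P_def)
  have "length p \<le> card I" if "P p" for p
    using that fin by (metis P_def card_mono distinct_card)
  then obtain p where p: "P p" and max: "\<And>q. P q \<Longrightarrow> length q \<le> length p"
    using ex_has_greatest_nat[of P "[u, y]" length "Suc (card I)"] P2 by (meson le_imp_less_Suc)
  have len: "length p \<ge> 2" using max[OF P2] by simp
  have edge: "{p ! i, p ! Suc i} \<in> F" if "Suc i < length p" for i using p that by (simp add: P_def)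
  have "z = p ! 1" if z: "{p ! 0, z} \<in> F" for z
  proof -
    have "z \<in> set p"
    proof (rule ccontr)
      assume "z \<notin> set p"
      then have "P (z # p)"
        using p z F[OF z] by (auto simp: P_def nth_Cons insert_commute split: nat.split)
      then show False using max by fastforce
    qed
    then obtain m where m: "m < length p" "z = p ! m" by (auto simp: in_set_conv_nth)
    have "m \<noteq> 0" using F(3)[OF z] m(2) by metis
    moreover have "\<not> m \<ge> 2"
    proof
      assume "m \<ge> 2"
      \<comment> \<open>The path from \<open>p ! 0\<close> to \<open>z = p ! m\<close>, closed by
        the edge back to \<open>p ! 0\<close>, has \<open>m + 1 \<ge> 3\<close> vertices.\<close>
      have "graph_cycle F (take (Suc m) p)"
        unfolding graph_cycle_def
      proof (intro conjI allI impI)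
        show "3 \<le> length (take (Suc m) p)" using m \<open>m \<ge> 2\<close> by simp
        show "distinct (take (Suc m) p)" using p by (simp add: P_def)
        fix i assume "i < length (take (Suc m) p)"
        then have i: "i \<le> m" by simp
        show "{take (Suc m) p ! i, take (Suc m) p ! (Suc i mod length (take (Suc m) p))} \<in> F"
        proof (cases "i = m")
          case True
          then show ?thesis using m z by (simp add: min_absorb2 insert_commute)
        next
          case False
          then show ?thesis using i m edge[of i] by (simp add: min_absorb2)
        qed
      qed
      then show False using acyc by blast
    qed
    ultimately have "m = 1" by linarith
    then show ?thesis using m by simp
  qed
  moreover have "{p ! 0, p ! 1} \<in> F" using edge[of 0] len by simp
  ultimately show ?thesis using F[of "p ! 0" "p ! 1"] by blast
qed

text \<open>A walk enters and leaves \<open>l\<close> through \<open>j\<close>, so the visit can be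
  cut out. \<open>J\<close> is a general node set because it stands both for the whole tree and for
  the nodes whose bags contain a fixed vertex.\<close>

lemma graph_connected_remove_leaf:
  assumes "graph_connected J (induced_edges F J)" "J - {l} \<noteq> {}" "\<And>x. {l, x} \<in> F \<Longrightarrow> x = j"
  shows "graph_connected (J - {l}) (induced_edges F (J - {l}))"
proof -
  have "(u, v) \<in> (adj_rel (induced_edges F (J - {l})))\<^sup>*" if "u \<in> J - {l}" "v \<in> J - {l}" for u v
  proof -
    have "(u, v) \<in> (adj_rel (induced_edges F J))\<^sup>*"
      using assms(1) that by (auto simp: graph_connected_def conn_rel_def)
    then show ?thesis
    proof (rule rtrancl_bypass[where w = l])
      fix a b
      assume "(a, l) \<in> adj_rel (induced_edges F J)" "(l, b) \<in> adj_rel (induced_edges F J)"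
      then have "a = j" "b = j"
        using assms(3) by (auto simp: adj_rel_def induced_edges_def insert_commute)
      then show "(a, b) \<in> (adj_rel (induced_edges F (J - {l})))\<^sup>*" by simp
    qed (use that in \<open>auto simp: adj_rel_def induced_edges_def\<close>)
  qed
  then show ?thesis using assms(2) by (auto simp: graph_connected_def conn_rel_def)
qed

lemma tree_remove_leaf:
  assumes "is_tree I F" "I - {l} \<noteq> {}" "\<And>x. {l, x} \<in> F \<Longrightarrow> x = j"
  shows "is_tree (I - {l}) (induced_edges F (I - {l}))"
proof -
  have "induced_edges F I = F"
    using assms(1) by (auto simp: is_tree_def simple_graph_def induced_edges_def)
  then have "graph_connected (I - {l}) (induced_edges F (I - {l}))"
    using graph_connected_remove_leaf[of I F l j] assms by (auto simp: is_tree_def)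
  moreover have "\<not> graph_cycle (induced_edges F (I - {l})) p" for p
    using assms(1) by (auto simp: is_tree_def graph_cycle_def induced_edges_def)
  ultimately show ?thesis
    using assms(1) by (auto simp: is_tree_def simple_graph_def induced_edges_def)
qed

text \<open>Induction on the number of nodes, removing a leaf \<open>l\<close> with neighbour
  \<open>j\<close>. The vertices that bag \<open>l\<close> shares with the remaining bags all lie in
  bag \<open>j\<close> and are already a clique, so the rest of bag \<open>l\<close> can be added to
  it.\<close>

lemma elimination_graph_of_bags:
  assumes "is_tree I F" "\<And>i. i \<in> I \<Longrightarrow> finite (B i) \<and> card (B i) \<le> k + 1"
    and "\<And>i v. i \<in> I \<Longrightarrow> v \<in> B i \<Longrightarrow>
      graph_connected {i\<in>I. v \<in> B i} (induced_edges F {i\<in>I. v \<in> B i})"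
  shows "elimination_graph k (\<Union>i\<in>I. B i) {{x, y} | x y. \<exists>i\<in>I. x \<in> B i \<and> y \<in> B i \<and> x \<noteq> y}"
  using assms
proof (induction "card I" arbitrary: I F rule: less_induct)
  case less
  have "finite I" "I \<noteq> {}"
    using less.prems(1) by (auto simp: is_tree_def simple_graph_def graph_connected_def)
  show ?case
  proof (cases "card I \<ge> 2")
    case False
    then have "card I = 1" using \<open>finite I\<close> \<open>I \<noteq> {}\<close> by (metis One_nat_def Suc_1 Suc_leI card_gt_0_iff le_antisym not_less_eq_eq)
    then obtain i where "I = {i}" using card_1_singletonE by blast
    then show ?thesis
      using elimination_graph_add_clique[OF elimination_graph.empty, of "B i" "{}" k] less.prems(2)
      by simp
  next
    case True
    then obtain l j where lj: "l \<in> I" "j \<in> I" "l \<noteq> j" and leaf: "\<And>x. {l, x} \<in> F \<Longrightarrow> x = j"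
      using tree_leaf[OF less.prems(1)] by metis
    let ?I = "I - {l}"
    let ?V = "\<Union>i\<in>?I. B i" and ?H = "\<lambda>I. {{x, y} | x y. \<exists>i\<in>I. x \<in> B i \<and> y \<in> B i \<and> x \<noteq> y}"
    have IH: "elimination_graph k ?V (?H ?I)"
    proof (rule less.hyps)
      show "card ?I < card I" using lj \<open>finite I\<close> by (meson card_Diff1_less)
      show "is_tree ?I (induced_edges F ?I)"
        using lj by (intro tree_remove_leaf[OF less.prems(1) _ leaf]) auto
      fix i v assume iv: "i \<in> ?I" "v \<in> B i"
      have "{i \<in> I. v \<in> B i} - {l} = {i \<in> ?I. v \<in> B i}" by auto
      moreover have "induced_edges (induced_edges F ?I) {i \<in> ?I. v \<in> B i} = induced_edges F {i \<in> ?I. v \<in> B i}"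
        by (auto simp: induced_edges_def)
      ultimately show "graph_connected {i \<in> ?I. v \<in> B i} (induced_edges (induced_edges F ?I) {i \<in> ?I. v \<in> B i})"
        using graph_connected_remove_leaf[OF less.prems(3)[of i v] _ leaf] iv by fastforce
    qed (use less.prems(2) in auto)
    \<comment> \<open>The nodes containing \<open>v\<close> are connected, and the only way out of
      \<open>l\<close> is to \<open>j\<close>.\<close>
    have Bj: "B l \<inter> ?V \<subseteq> B j"
    proof
      fix v assume v: "v \<in> B l \<inter> ?V"
      then obtain i where i: "i \<in> I" "i \<noteq> l" "v \<in> B i" by auto
      then have "(l, i) \<in> (adj_rel (induced_edges F {i\<in>I. v \<in> B i}))\<^sup>*"
        using less.prems(3)[of l v] lj v by (auto simp: graph_connected_def conn_rel_def)
      then obtain x where "(l, x) \<in> adj_rel (induced_edges F {i\<in>I. v \<in> B i})"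
        using i(2) by (auto elim: converse_rtranclE)
      then show "v \<in> B j" using leaf[of x] by (auto simp: adj_rel_def induced_edges_def)
    qed
    let ?N = "B l \<inter> ?V" and ?M = "B l - ?V"
    have NM: "?N \<union> ?M = B l" by auto
    have "elimination_graph k (?V \<union> ?M) (?H ?I \<union> {{x, y} | x y. x \<in> ?N \<union> ?M \<and> y \<in> ?N \<union> ?M \<and> x \<noteq> y})"
    proof (rule elimination_graph_add_clique[OF IH])
      show "card (?N \<union> ?M) \<le> k + 1" "finite ?M" using less.prems(2) lj NM by auto
      fix x y assume "x \<in> ?N" "y \<in> ?N" "x \<noteq> y"
      moreover from this have "x \<in> B j" "y \<in> B j" using Bj by blast+
      ultimately show "{x, y} \<in> ?H ?I" using lj by blast
    qed auto
    moreover have "?V \<union> ?M = (\<Union>i\<in>I. B i)" using lj by auto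
    moreover have "?H ?I \<union> {{x, y} | x y. x \<in> B l \<and> y \<in> B l \<and> x \<noteq> y} = ?H I" using lj by blast
    ultimately show ?thesis unfolding NM by simp
  qed
qed

text \<open>The decomposition with the single bag \<open>V\<close> shows that the minimum is
  attained, and bounds it. The bound later gives at least two vertices whenever the treewidth is
  positive.\<close>

lemma treewidth_decomposition:
  assumes "simple_graph V E"
  shows "\<exists>(I :: nat set) F B. tree_decomposition V E I F B \<and> decomposition_width I B = treewidth V E"
    and "treewidth V E \<le> card V - 1"
proof -
  let ?P = "\<lambda>w. \<exists>(I :: nat set) F B. tree_decomposition V E I F B \<and> decomposition_width I B = w"
  have "tree_decomposition V E {0 :: nat} {} (\<lambda>_. V)"
    using assms
    by (auto simp: tree_decomposition_def is_tree_def simple_graph_def graph_connected_def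
        conn_rel_def graph_cycle_def intro: exI[of _ 0])
  moreover have "decomposition_width {0 :: nat} (\<lambda>_. V) = card V - 1"
    by (simp add: decomposition_width_def)
  ultimately have *: "?P (card V - 1)"
    by blast
  show "\<exists>(I :: nat set) F B. tree_decomposition V E I F B \<and> decomposition_width I B = treewidth V E"
    unfolding treewidth_def using LeastI[of ?P, OF *] .
  show "treewidth V E \<le> card V - 1"
    unfolding treewidth_def using Least_le[of ?P, OF *] .
qed

lemma treewidth_elimination_graph:
  assumes "simple_graph V E"
  shows "\<exists>H. E \<subseteq> H \<and> elimination_graph (treewidth V E) V H"
proof -
  obtain I :: "nat set" and F B where td: "tree_decomposition V E I F B"
    and w: "decomposition_width I B = treewidth V E"
    using treewidth_decomposition(1)[OF assms] by blast
  have tree: "is_tree I F" and V: "(\<Union>i\<in>I. B i) = V" and E: "\<And>e. e \<in> E \<Longrightarrow> \<exists>i\<in>I. e \<subseteq> B i"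
    and conn: "\<And>v. v \<in> V \<Longrightarrow> graph_connected {i\<in>I. v \<in> B i} (induced_edges F {i\<in>I. v \<in> B i})"
    using td by (auto simp: tree_decomposition_def)
  have "finite I" using tree by (simp add: is_tree_def simple_graph_def)
  have bag: "finite (B i) \<and> card (B i) \<le> treewidth V E + 1" if "i \<in> I" for i
  proof
    show "finite (B i)" using V that assms by (auto simp: simple_graph_def intro: finite_subset)
    have "card (B i) \<le> Max ((\<lambda>i. card (B i)) ` I)" using that \<open>finite I\<close> by simp
    \<comment> \<open>From \<open>Max - 1 = treewidth\<close> follows
      \<open>Max \<le> treewidth + 1\<close> even where the subtraction truncates.\<close>
    then show "card (B i) \<le> treewidth V E + 1" using w by (simp add: decomposition_width_def)
  qed
  let ?H = "{{x, y} | x y. \<exists>i\<in>I. x \<in> B i \<and> y \<in> B i \<and> x \<noteq> y}"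
  have "elimination_graph (treewidth V E) (\<Union>i\<in>I. B i) ?H"
    using conn V by (intro elimination_graph_of_bags[OF tree bag]) auto
  moreover have "E \<subseteq> ?H"
  proof
    fix e assume e: "e \<in> E"
    then obtain x y where "e = {x, y}" "x \<noteq> y"
      using assms by (auto simp: simple_graph_def card_2_iff)
    then show "e \<in> ?H" using E[OF e] by blast
  qed
  ultimately show ?thesis using V by auto
qed

section \<open>Separating families\<close>

text \<open>Double counting of the pairs with \<open>\<not> P x y\<close>: on average over
  \<open>Y\<close>, at most the share \<open>1 - \<delta>\<close> of \<open>X\<close> is missed, and
  some \<open>y\<close> does no worse than the average.\<close>

lemma averaging_cover_step:
  fixes \<delta> :: real
  assumes "finite X" "finite Y" "Y \<noteq> {}"
    and "\<And>x. x \<in> X \<Longrightarrow> real (card {y \<in> Y. P x y}) \<ge> \<delta> * card Y"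
  shows "\<exists>y\<in>Y. real (card {x \<in> X. \<not> P x y}) \<le> (1 - \<delta>) * card X"
proof (rule ccontr)
  assume "\<not> ?thesis"
  then have less: "(1 - \<delta>) * card X < real (card {x \<in> X. \<not> P x y})" if "y \<in> Y" for y
    using that by (auto simp: not_le)
  have ind: "(\<Sum>z\<in>Z. of_bool (Q z)) = real (card {z \<in> Z. Q z})" if "finite Z" for Z :: "'z set" and Q
    using that by (simp add: Int_def)
  have "card Y * ((1 - \<delta>) * card X) < (\<Sum>y\<in>Y. real (card {x \<in> X. \<not> P x y}))"
    using sum_strict_mono[OF assms(2,3) less] by simp
  also have "\<dots> = (\<Sum>y\<in>Y. \<Sum>x\<in>X. 1 - of_bool (P x y))"
    using assms(1) by (simp add: Int_def flip: of_bool_not_iff)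
  also have "\<dots> = (\<Sum>x\<in>X. \<Sum>y\<in>Y. 1 - of_bool (P x y))" by (rule sum.swap)
  also have "\<dots> = (\<Sum>x\<in>X. card Y - real (card {y \<in> Y. P x y}))"
    using assms(2) by (simp add: sum_subtractf Int_def)
  also have "\<dots> \<le> (\<Sum>x\<in>X. card Y - \<delta> * card Y)"
    using assms(4) by (intro sum_mono) auto
  finally show False by (simp add: algebra_simps)
qed

text \<open>Greedy choice in place of independent random samples: each new element is good for the
  \<open>x\<close> missed so far, and shrinks their number by the factor
  \<open>1 - \<delta>\<close>.\<close>

lemma averaging_cover:
  fixes \<delta> :: real
  assumes "finite X" "finite Y" "Y \<noteq> {}" "\<delta> \<le> 1"
    and "\<And>x. x \<in> X \<Longrightarrow> real (card {y \<in> Y. P x y}) \<ge> \<delta> * card Y"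
  shows "\<exists>ys. length ys = m \<and> set ys \<subseteq> Y \<and>
    real (card {x \<in> X. \<forall>y\<in>set ys. \<not> P x y}) \<le> (1 - \<delta>) ^ m * card X"
proof (induction m)
  case 0
  then show ?case by simp
next
  case (Suc m)
  then obtain ys where ys: "length ys = m" "set ys \<subseteq> Y"
    "real (card {x \<in> X. \<forall>y\<in>set ys. \<not> P x y}) \<le> (1 - \<delta>) ^ m * card X" by blast
  let ?X = "{x \<in> X. \<forall>y\<in>set ys. \<not> P x y}"
  obtain y where y: "y \<in> Y" "real (card {x \<in> ?X. \<not> P x y}) \<le> (1 - \<delta>) * card ?X"
    using averaging_cover_step[of ?X Y \<delta> P] assms by auto
  have "{x \<in> ?X. \<not> P x y} = {x \<in> X. \<forall>z\<in>set (y # ys). \<not> P x z}" by auto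
  moreover have "(1 - \<delta>) * card ?X \<le> (1 - \<delta>) * ((1 - \<delta>) ^ m * card X)"
    using ys(3) assms(4) by (intro mult_left_mono) auto
  ultimately show ?case using y ys by (intro exI[of _ "y # ys"]) auto
qed

section \<open>Numerical estimates\<close>

text \<open>Lets additive constants be absorbed into multiples of
  \<open>k ^ 3 * ln n\<close>.\<close>

lemma ln_ge_half:
  assumes "n \<ge> (2 :: nat)"
  shows "ln (real n) \<ge> 1 / 2"
proof -
  have "ln (1 / real n) \<le> 1 / real n - 1" using assms by (intro ln_le_minus_one) auto
  moreover have "1 / real n \<le> 1 / 2" using assms by (simp add: divide_simps)
  moreover have "ln (1 / real n) = - ln (real n)" using assms by (simp add: ln_div)
  ultimately show ?thesis by linarith
qed

text \<open>The reciprocal is \<open>(1 + 1 / k) ^ k\<close>, which is at most e and so at most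
  3.\<close>

lemma power_ratio_ge:
  assumes "k \<ge> (1 :: nat)"
  shows "(real k / (real k + 1)) ^ k \<ge> 1 / 3"
proof -
  have "(1 + 1 / real k) ^ k \<le> exp (1 / real k) ^ k"
    by (intro power_mono exp_ge_add_one_self) auto
  also have "\<dots> = exp 1" using assms by (simp flip: exp_of_nat_mult)
  also have "\<dots> \<le> 3" by (rule exp_le)
  finally have *: "(1 + 1 / real k) ^ k \<le> 3" .
  have "(real k / (real k + 1)) ^ k = inverse ((1 + 1 / real k) ^ k)"
    using assms by (simp add: field_simps flip: power_inverse)
  moreover have "(1 + 1 / real k) ^ k > 0" by (intro zero_less_power) (simp add: add_pos_nonneg)
  ultimately show ?thesis using le_imp_inverse_le[OF *] by (simp add: inverse_eq_divide)
qed

text \<open>The zero set of a uniformly random \<open>f\<close> contains each vertex independently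
  with probability \<open>1 / (k + 1)\<close>. It contains \<open>u\<close> and \<open>v\<close> and
  misses \<open>T\<close> with probability at least
  \<open>(1 / (k + 1)) ^ 2 * (k / (k + 1)) ^ k\<close>.\<close>

lemma card_functions_separating:
  assumes "finite V" "k \<ge> 1" "u \<in> V" "v \<in> V" "T \<subseteq> V - {u, v}" "card T \<le> k"
  shows "real (card {f \<in> V \<rightarrow>\<^sub>E {..k}. f u = 0 \<and> f v = 0 \<and> (\<forall>x\<in>T. f x \<noteq> 0)})
    \<ge> 1 / (12 * real k ^ 2) * real (card (V \<rightarrow>\<^sub>E {..k}))"
proof -
  let ?g = "\<lambda>x. if x \<in> {u, v} then {0} else if x \<in> T then {1..k} else {..k}"
  let ?r = "\<lambda>x. real (card (?g x)) / (real k + 1)"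
  have finT: "finite T" using assms finite_subset by blast
  have *: "{f \<in> V \<rightarrow>\<^sub>E {..k}. f u = 0 \<and> f v = 0 \<and> (\<forall>x\<in>T. f x \<noteq> 0)} = PiE V ?g"
    using assms(3-5) by (fastforce simp: PiE_iff Ball_def subset_iff Suc_le_eq split: if_splits)
  have prodT: "(\<Prod>x\<in>T. ?r x) = (real k / (real k + 1)) ^ card T"
  proof -
    have "(\<Prod>x\<in>T. ?r x) = (\<Prod>x\<in>T. real k / (real k + 1))"
      using assms(5) by (intro prod.cong) auto
    then show ?thesis by simp
  qed
  \<comment> \<open>If \<open>u = v\<close>, the product has only one factor, hence an
    inequality.\<close>
  have prodW: "(\<Prod>x\<in>{u, v}. ?r x) \<ge> (1 / (real k + 1)) ^ 2"
    by (cases "u = v") (auto simp: power2_eq_square divide_simps)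
  have "1 / (12 * real k ^ 2) \<le> (1 / (real k + 1)) ^ 2 * (1 / 3)"
  proof -
    \<comment> \<open>The 12 is 4 times 3: the 4 from \<open>k + 1 \<le> 2 * k\<close>, the 3 from
      \<open>power_ratio_ge\<close>.\<close>
    have "(real k + 1) ^ 2 \<le> (2 * real k) ^ 2" using assms(2) by (intro power_mono) auto
    then have "3 * (real k + 1) ^ 2 \<le> 12 * real k ^ 2" by (simp add: power_mult_distrib)
    then have "1 / (12 * real k ^ 2) \<le> 1 / (3 * (real k + 1) ^ 2)"
      using assms(2) by (intro divide_left_mono) (auto intro!: mult_pos_pos)
    then show ?thesis by (simp add: power_divide)
  qed
  also have "\<dots> \<le> (1 / (real k + 1)) ^ 2 * (real k / (real k + 1)) ^ k"
    using power_ratio_ge[OF assms(2)] by (intro mult_left_mono) auto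
  also have "\<dots> \<le> (1 / (real k + 1)) ^ 2 * (real k / (real k + 1)) ^ card T"
    using assms(6) by (intro mult_left_mono power_decreasing) auto
  also have "\<dots> \<le> (\<Prod>x\<in>{u, v}. ?r x) * (\<Prod>x\<in>T. ?r x)"
    unfolding prodT using prodW by (intro mult_right_mono) auto
  also have "\<dots> = (\<Prod>x\<in>{u, v} \<union> T. ?r x)"
    using assms(5) finT by (intro prod.union_disjoint[symmetric]) auto
  \<comment> \<open>Every other vertex admits all \<open>k + 1\<close> values and contributes the
    factor 1.\<close>
  also have "\<dots> = (\<Prod>x\<in>V. ?r x)"
    using assms(1,3-5) by (intro prod.mono_neutral_left) auto
  also have "\<dots> = real (card (PiE V ?g)) / real (card (V \<rightarrow>\<^sub>E {..k}))"
    using assms(1) by (simp add: card_PiE prod_dividef add.commute)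
  finally show ?thesis
    using assms(1) unfolding * by (simp add: card_PiE field_simps)
qed

text \<open>There are \<open>n ^ (k + 2)\<close> coded triples of \<open>u\<close>, \<open>v\<close>
  and \<open>T\<close>. After \<open>m\<close> greedy choices fewer than one of them is missed,
  hence none.\<close>

lemma separating_family:
  fixes V :: "'a set"
  assumes "finite V" "card V \<ge> 2" "k \<ge> 1"
  shows "\<exists>Ss. real (length Ss) \<le> 38 * real k ^ 3 * ln (card V) \<and> (\<forall>S\<in>set Ss. S \<subseteq> V) \<and>
    (\<forall>u\<in>V. \<forall>v\<in>V. \<forall>T. T \<subseteq> V - {u, v} \<and> card T \<le> k \<longrightarrow>
      (\<exists>S\<in>set Ss. u \<in> S \<and> v \<in> S \<and> S \<inter> T = {}))"
proof -
  define Y where "Y = V \<rightarrow>\<^sub>E {..k}"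
  \<comment> \<open>\<open>T\<close> is coded by a list of length exactly \<open>k\<close>; to pad it even if \<open>V = {u, v}\<close>, the
    entries \<open>u\<close> and \<open>v\<close> are ignored.\<close>
  define X where "X = V \<times> V \<times> {ts. set ts \<subseteq> V \<and> length ts = k}"
  define P where "P = (\<lambda>(u :: 'a, v, ts) f. f u = 0 \<and> f v = 0 \<and> (\<forall>x\<in>set ts - {u, v}. f x \<noteq> (0 :: nat)))"
  define \<delta> where "\<delta> = 1 / (12 * real k ^ 2)"
  \<comment> \<open>\<open>m\<close> must exceed \<open>(k + 2) * ln n / \<delta>\<close>;
    \<open>k + 2 \<le> 3 * k\<close> and \<open>1 / \<delta> = 12 * k ^ 2\<close> give the 36.
    Adding 1 to the floor makes the inequality strict.\<close>
  define m where "m = nat \<lfloor>36 * real k ^ 3 * ln (card V)\<rfloor> + 1"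
  let ?n = "real (card V)"
  have finX: "finite X" and finY: "finite Y"
    using assms(1) by (auto simp: X_def Y_def finite_lists_length_eq intro!: finite_PiE)
  have "Y \<noteq> {}" by (auto simp: Y_def PiE_eq_empty_iff)
  have cardX: "real (card X) = ?n ^ (k + 2)"
    using assms(1) by (simp add: X_def card_cartesian_product card_lists_length_eq power2_eq_square)
  have k1: "real k ^ 2 \<ge> 1" using assms(3) by simp
  have \<delta>: "0 < \<delta>" "\<delta> \<le> 1" using k1 assms(3) unfolding \<delta>_def by (simp, subst divide_le_eq_1_pos) linarith+
  have lnn: "ln ?n \<ge> 1 / 2"
    using ln_ge_half[OF assms(2)] .
  have k3: "real k ^ 3 \<ge> 1" using assms(3) by simp
  have half: "real k ^ 3 * ln ?n \<ge> 1 / 2" using mult_mono[OF k3 lnn] k3 by simp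
  have "36 * real k ^ 3 * ln ?n \<ge> 0" using half by linarith
  then have m: "36 * real k ^ 3 * ln ?n < m" "m \<le> 36 * real k ^ 3 * ln ?n + 1"
    unfolding m_def by linarith+
  have "real (card {f \<in> Y. P x f}) \<ge> \<delta> * card Y" if "x \<in> X" for x
  proof -
    obtain u v ts where x: "x = (u, v, ts)" by (cases x)
    have "card (set ts - {u, v}) \<le> k"
      using that card_length[of ts] card_mono[OF _ Diff_subset, of "set ts" "{u, v}"]
      by (simp add: X_def x)
    then show ?thesis
      using card_functions_separating[OF assms(1,3), of u v "set ts - {u, v}"] that
      by (auto simp: X_def Y_def P_def \<delta>_def x)
  qed
  then obtain fs where fs: "length fs = m" "set fs \<subseteq> Y"
    "real (card {x \<in> X. \<forall>f\<in>set fs. \<not> P x f}) \<le> (1 - \<delta>) ^ m * card X"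
    using averaging_cover[OF finX finY \<open>Y \<noteq> {}\<close> \<delta>(2), of P m] by blast
  have "(1 - \<delta>) ^ m \<le> exp (- \<delta>) ^ m"
    using \<delta> exp_ge_add_one_self[of "- \<delta>"] by (intro power_mono) auto
  also have "\<dots> = exp (- (\<delta> * m))" by (simp flip: exp_of_nat_mult add: mult.commute)
  also have "\<dots> < exp (- (real (k + 2) * ln ?n))"
  proof -
    have "real (k + 2) * ln ?n \<le> 3 * real k * ln ?n"
      using assms(3) lnn by (intro mult_right_mono) auto
    also have "\<dots> = \<delta> * (36 * real k ^ 3 * ln ?n)"
      using assms(3) by (simp add: \<delta>_def field_simps power2_eq_square power3_eq_cube)
    also have "\<dots> < \<delta> * m" using m \<delta> by (intro mult_strict_left_mono) auto
    finally show ?thesis by simp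
  qed
  also have "\<dots> = inverse (?n ^ (k + 2))"
    using assms(2) by (simp only: exp_minus exp_of_nat_mult) simp
  finally have "(1 - \<delta>) ^ m * card X < inverse (?n ^ (k + 2)) * ?n ^ (k + 2)"
    unfolding cardX using assms(2) by (intro mult_strict_right_mono) auto
  also have "\<dots> = 1" using assms(2) by (intro left_inverse) auto
  finally have "card {x \<in> X. \<forall>f\<in>set fs. \<not> P x f} = 0" using fs(3) by linarith
  then have "{x \<in> X. \<forall>f\<in>set fs. \<not> P x f} = {}" using finX by (subst (asm) card_0_eq) auto
  then have cover: "\<exists>f\<in>set fs. P x f" if "x \<in> X" for x using that by blast
  define Ss where "Ss = map (\<lambda>f. {x \<in> V. f x = 0}) fs"
  have "\<exists>S\<in>set Ss. u \<in> S \<and> v \<in> S \<and> S \<inter> T = {}"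
    if "u \<in> V" "v \<in> V" "T \<subseteq> V - {u, v}" "card T \<le> k" for u v T
  proof -
    have "finite T" using that assms(1) finite_subset by blast
    then obtain ts where ts: "set ts = T" "distinct ts" using finite_distinct_list by blast
    let ?ts = "ts @ replicate (k - card T) u"
    have len: "length ?ts = k" using ts that(4) distinct_card[of ts] by simp
    have set_ts: "set ?ts - {u, v} = T" using ts that by auto
    have "set ?ts \<subseteq> V" using ts that by auto
    then have "(u, v, ?ts) \<in> X" using that len unfolding X_def by blast
    from cover[OF this] obtain f where "f \<in> set fs" "P (u, v, ?ts) f" by blast
    then have "f \<in> set fs" "f u = 0" "f v = 0" "\<forall>x\<in>T. f x \<noteq> 0"
      unfolding P_def prod.case set_ts by blast+
    then show ?thesis using that by (intro bexI[of _ "{x \<in> V. f x = 0}"]) (auto simp: Ss_def)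
  qed
  \<comment> \<open>The rounding costs 1, which is at most \<open>2 * k ^ 3 * ln n\<close> by
    \<open>half\<close>; this turns 36 into 38.\<close>
  moreover have "real (length Ss) \<le> 38 * real k ^ 3 * ln ?n"
    using fs(1) m(2) half by (simp add: Ss_def)
  moreover have "\<forall>S\<in>set Ss. S \<subseteq> V" by (auto simp: Ss_def)
  ultimately show ?thesis by blast
qed

section \<open>The algorithm\<close>

text \<open>One non-adaptive round. The continuation \<open>K\<close> receives the transcript, so
  rounds can be chained and adaptivity occurs only between them.\<close>

primrec query_all :: "'a set list \<Rightarrow> (('a set \<times> 'a set set) list \<Rightarrow> 'a query_alg) \<Rightarrow> 'a query_alg" where
  "query_all [] K = K []"
| "query_all (S # Ss) K = Query S (\<lambda>P. query_all Ss (\<lambda>L. K ((S, P) # L)))"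

lemma run_output_query_all [simp]:
  "run_output orc (query_all Ss K) = run_output orc (K (map (\<lambda>S. (S, orc S)) Ss))"
  by (induction Ss arbitrary: K) auto

lemma run_queries_query_all [simp]:
  "run_queries orc (query_all Ss K) = Ss @ run_queries orc (K (map (\<lambda>S. (S, orc S)) Ss))"
  by (induction Ss arbitrary: K) auto

text \<open>Computed from the transcript alone, so the algorithm can use it both as the intermediate
  graph \<open>H\<close> and as its output.\<close>

definition unseparated :: "'a set \<Rightarrow> ('a set \<times> 'a set set) list \<Rightarrow> 'a set set" where
  "unseparated V L = {{u, v} | u v. u \<in> V \<and> v \<in> V \<and> u \<noteq> v \<and>
     (\<forall>(S, P)\<in>set L. u \<in> S \<longrightarrow> v \<in> S \<longrightarrow> (\<exists>C\<in>P. u \<in> C \<and> v \<in> C))}"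

lemma unseparated_antimono: "set L \<subseteq> set L' \<Longrightarrow> unseparated V L' \<subseteq> unseparated V L"
  unfolding unseparated_def by (intro Collect_mono ex_mono conj_mono imp_refl impI ballI) (meson subsetD)

lemma same_component_iff:
  assumes "u \<in> S" "v \<in> S"
  shows "(\<exists>C\<in>cc_oracle E S. u \<in> C \<and> v \<in> C) \<longleftrightarrow> (u, v) \<in> (adj_rel (induced_edges E S))\<^sup>*"
    (is "?L \<longleftrightarrow> ?R")
proof
  assume ?L
  then obtain x where "(x, u) \<in> (adj_rel (induced_edges E S))\<^sup>*" "(x, v) \<in> (adj_rel (induced_edges E S))\<^sup>*"
    by (auto simp: cc_oracle_def graph_components_def quotient_def conn_rel_def)
  then show ?R using adj_rel_rtrancl_commute rtrancl_trans by metis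
next
  assume ?R
  then show ?L using assms
    by (auto simp: cc_oracle_def graph_components_def quotient_def conn_rel_def intro!: bexI[of _ u])
qed

lemma unseparated_cc_oracle:
  "unseparated V (map (\<lambda>S. (S, cc_oracle E S)) Ss) = {{u, v} | u v. u \<in> V \<and> v \<in> V \<and> u \<noteq> v \<and>
     (\<forall>S\<in>set Ss. u \<in> S \<longrightarrow> v \<in> S \<longrightarrow> (u, v) \<in> (adj_rel (induced_edges E S))\<^sup>*)}"
  unfolding unseparated_def by (simp add: same_component_iff cong: imp_cong)

text \<open>No true edge is ever discarded: a query containing both ends also contains the edge that
  joins them.\<close>

lemma subset_unseparated:
  assumes "simple_graph V E"
  shows "E \<subseteq> unseparated V (map (\<lambda>S. (S, cc_oracle E S)) Ss)"
proof
  fix e assume e: "e \<in> E"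
  then obtain u v where uv: "e = {u, v}" "u \<noteq> v" "u \<in> V" "v \<in> V"
    using assms by (force simp: simple_graph_def card_2_iff)
  moreover have "(u, v) \<in> (adj_rel (induced_edges E S))\<^sup>*" if "u \<in> S" "v \<in> S" for S
    using that e uv by (intro r_into_rtrancl) (auto simp: adj_rel_def induced_edges_def)
  ultimately show "e \<in> unseparated V (map (\<lambda>S. (S, cc_oracle E S)) Ss)"
    unfolding unseparated_cc_oracle by blast
qed

lemma unseparatedD:
  assumes "{u, v} \<in> unseparated V (map (\<lambda>S. (S, cc_oracle E S)) Ss)" "S \<in> set Ss" "u \<in> S" "v \<in> S"
  shows "(u, v) \<in> (adj_rel (induced_edges E S))\<^sup>*"
proof -
  obtain x y where "{u, v} = {x, y}" "(x, y) \<in> (adj_rel (induced_edges E S))\<^sup>*"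
    using assms unfolding unseparated_cc_oracle by (auto simp: doubleton_eq_iff)
  then show ?thesis
    using adj_rel_rtrancl_commute[of x y] by (auto simp: doubleton_eq_iff)
qed

lemma unseparated_edges:
  assumes "e \<in> unseparated V L"
  obtains u v where "e = {u, v}" "u \<in> V" "v \<in> V" "u \<noteq> v"
  using assms unfolding unseparated_def by blast

section \<open>The two rounds of queries\<close>

definition separating_sets :: "'a set \<Rightarrow> nat \<Rightarrow> 'a set list" where
  "separating_sets V k = (SOME Ss. real (length Ss) \<le> 38 * real k ^ 3 * ln (card V) \<and>
    (\<forall>S\<in>set Ss. S \<subseteq> V) \<and> (\<forall>u\<in>V. \<forall>v\<in>V. \<forall>T. T \<subseteq> V - {u, v} \<and> card T \<le> k \<longrightarrow>
      (\<exists>S\<in>set Ss. u \<in> S \<and> v \<in> S \<and> S \<inter> T = {})))"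

text \<open>The fixed choice depends on \<open>V\<close>, \<open>k\<close> and \<open>H\<close>
  only; \<open>H'\<close> and its colouring, unknown to the algorithm, just guarantee that a
  suitable list exists.\<close>

definition bridge_sets :: "'a set \<Rightarrow> nat \<Rightarrow> 'a set set \<Rightarrow> 'a set list" where
  "bridge_sets V k H = (SOME Ts. length Ts = (k + 1)\<^sup>2 \<and> (\<forall>S\<in>set Ts. S \<subseteq> V) \<and>
    (\<forall>u v. {u, v} \<in> H \<longrightarrow> (\<exists>S\<in>set Ts. u \<in> S \<and> v \<in> S \<and>
      (u, v) \<notin> (adj_rel (induced_edges (H - {{u, v}}) S))\<^sup>*)))"

text \<open>For \<open>k = 0\<close> the query bound is zero, so the edgeless graph must be output
  without asking anything.\<close>

definition reconstruct :: "'a set \<Rightarrow> nat \<Rightarrow> 'a query_alg" where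
  "reconstruct V k = (if k = 0 then Output {} else
    query_all (separating_sets V k) (\<lambda>L.
      query_all (bridge_sets V k (unseparated V L)) (\<lambda>L'. Output (unseparated V (L @ L')))))"

lemma reconstruct_correct:
  assumes "simple_graph V E" "V \<noteq> {}" "treewidth V E = k"
  shows "run_output (cc_oracle E) (reconstruct V k) = E" (is ?out)
    and "\<forall>S\<in>set (run_queries (cc_oracle E) (reconstruct V k)). S \<subseteq> V" (is ?sub)
    and "real (length (run_queries (cc_oracle E) (reconstruct V k)))
      \<le> 46 * real k ^ 3 * ln (real (card V))" (is ?len)
proof -
  obtain H' where H': "E \<subseteq> H'" "elimination_graph k V H'"
    using treewidth_elimination_graph[OF assms(1)] assms(3) by blast
  have "?out \<and> ?sub \<and> ?len"
  proof (cases "k = 0")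
    case True
    then show ?thesis using H' elimination_graph_0 by (auto simp: reconstruct_def)
  next
    case False
    have "finite V" using assms(1) by (simp add: simple_graph_def)
    have n: "card V \<ge> 2" using treewidth_decomposition(2)[OF assms(1)] assms(3) False by simp
    define Ss where "Ss = separating_sets V k"
    have Ss: "real (length Ss) \<le> 38 * real k ^ 3 * ln (card V)" "\<forall>S\<in>set Ss. S \<subseteq> V"
      and sep: "\<And>u v T. u \<in> V \<Longrightarrow> v \<in> V \<Longrightarrow> T \<subseteq> V - {u, v} \<Longrightarrow> card T \<le> k \<Longrightarrow>
        \<exists>S\<in>set Ss. u \<in> S \<and> v \<in> S \<and> S \<inter> T = {}"
      using someI_ex[OF separating_family[OF \<open>finite V\<close> n, of k]] False
      unfolding Ss_def separating_sets_def by auto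
    let ?ans = "map (\<lambda>S. (S, cc_oracle E S))"
    define H where "H = unseparated V (?ans Ss)"
    have "E \<subseteq> H" unfolding H_def by (rule subset_unseparated[OF assms(1)])
    have "H \<subseteq> H'"
    proof
      fix e assume e: "e \<in> H"
      then obtain u v where uv: "e = {u, v}" "u \<in> V" "v \<in> V" "u \<noteq> v"
        unfolding H_def by (rule unseparated_edges)
      show "e \<in> H'"
      proof (rule ccontr)
        assume "e \<notin> H'"
        then obtain T where T: "T \<subseteq> V - {u, v}" "card T \<le> k"
          "(u, v) \<notin> (adj_rel (induced_edges H' (V - T)))\<^sup>*"
          using elimination_graph_separator[OF H'(2) uv(2-4)] uv(1) by blast
        \<comment> \<open>A query \<open>S\<close> avoiding \<open>T\<close> sees only a part of
          \<open>H'\<close> without \<open>T\<close>, so its answer separates \<open>u\<close> and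
          \<open>v\<close>, contrary to their membership in \<open>H\<close>.\<close>
        obtain S where S: "S \<in> set Ss" "u \<in> S" "v \<in> S" "S \<inter> T = {}"
          using sep[OF uv(2,3) T(1,2)] by blast
        have "(u, v) \<in> (adj_rel (induced_edges E S))\<^sup>*"
          using e S(1-3) unfolding H_def uv(1) by (rule unseparatedD)
        moreover have "induced_edges E S \<subseteq> induced_edges H' (V - T)"
          using Ss(2) S H'(1) by (fastforce simp: induced_edges_def)
        ultimately show False using T(3) adj_rel_rtrancl_mono by metis
      qed
    qed
    define Ts where "Ts = bridge_sets V k H"
    have Ts: "length Ts = (k + 1)\<^sup>2" "\<forall>S\<in>set Ts. S \<subseteq> V"
      and bridge: "\<And>u v. {u, v} \<in> H \<Longrightarrow> \<exists>S\<in>set Ts. u \<in> S \<and> v \<in> S \<and>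
        (u, v) \<notin> (adj_rel (induced_edges (H - {{u, v}}) S))\<^sup>*"
      using someI_ex[OF elimination_graph_bridge_sets[OF H'(2) \<open>H \<subseteq> H'\<close>]]
      unfolding Ts_def bridge_sets_def by auto
    have out: "run_output (cc_oracle E) (reconstruct V k) = unseparated V (?ans (Ss @ Ts))"
      and qs: "run_queries (cc_oracle E) (reconstruct V k) = Ss @ Ts"
      using False by (simp_all add: reconstruct_def Ss_def Ts_def H_def)
    have "unseparated V (?ans (Ss @ Ts)) \<subseteq> E"
    proof
      fix e assume e: "e \<in> unseparated V (?ans (Ss @ Ts))"
      then obtain u v where uv: "e = {u, v}" by (rule unseparated_edges)
      have "e \<in> H" using e unseparated_antimono[of "?ans Ss" "?ans (Ss @ Ts)"] by (auto simp: H_def)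
      then obtain S where S: "S \<in> set Ts" "u \<in> S" "v \<in> S"
        "(u, v) \<notin> (adj_rel (induced_edges (H - {{u, v}}) S))\<^sup>*"
        using bridge uv by blast
      have con: "(u, v) \<in> (adj_rel (induced_edges E S))\<^sup>*"
        using unseparatedD[of u v V E "Ss @ Ts" S] e S uv by simp
      show "e \<in> E"
      proof (rule ccontr)
        assume "e \<notin> E"
        \<comment> \<open>A non-edge \<open>e\<close> of the hidden graph leaves \<open>E\<close>
          inside \<open>H\<close> without \<open>e\<close>, where \<open>e\<close> was a bridge; yet
          the answer for \<open>S\<close> connects its ends.\<close>
        then have "induced_edges E S \<subseteq> induced_edges (H - {{u, v}}) S"
          using \<open>E \<subseteq> H\<close> uv by (auto simp: induced_edges_def)
        then show False using con S(4) adj_rel_rtrancl_mono by metis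
      qed
    qed
    then have ?out using subset_unseparated[OF assms(1)] out by blast
    moreover have ?sub using Ss(2) Ts(2) qs by auto
    moreover have ?len
    proof -
      have k: "real k \<ge> 1" using False by simp
      have lnn: "ln (card V) \<ge> 1 / 2"
        using ln_ge_half[OF n] .
      \<comment> \<open>The second round is absorbed by
        \<open>(k + 1)^2 \<le> 4 * k^2 \<le> 4 * k^3 \<le> 8 * k^3 * ln n\<close>.\<close>
      have "real (k + 1) ^ 2 \<le> (2 * real k) ^ 2" using k by (intro power_mono) auto
      also have "\<dots> \<le> 4 * real k ^ 3"
        using k by (simp add: power_mult_distrib power_increasing)
      also have "\<dots> \<le> 8 * real k ^ 3 * ln (card V)"
        using mult_left_mono[OF lnn, of "8 * real k ^ 3"] by simp
      finally have "real (length Ts) \<le> 8 * real k ^ 3 * ln (card V)"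
        unfolding Ts(1) by simp
      then show ?thesis using Ss(1) qs by simp
    qed
    ultimately show ?thesis by blast
  qed
  then show ?out ?sub ?len by auto
qed

theorem theorem6:
  shows "\<exists>(C :: real) (A :: 'a set \<Rightarrow> nat \<Rightarrow> 'a query_alg).
    \<forall>V k E. simple_graph V E \<and> V \<noteq> {} \<and> treewidth V E = k \<longrightarrow>
      run_output (cc_oracle E) (A V k) = E \<and>
      (\<forall>S \<in> set (run_queries (cc_oracle E) (A V k)). S \<subseteq> V) \<and>
      real (length (run_queries (cc_oracle E) (A V k))) \<le> C * real k ^ 3 * ln (real (card V))"
\<comment> \<open>46 is 38 for the first round plus 8 for the second.\<close>
proof (intro exI[of _ "46 :: real"] exI[of _ reconstruct] allI impI, elim conjE)
  fix V :: "'a set" and k E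
  assume "simple_graph V E" "V \<noteq> {}" "treewidth V E = k"
  from reconstruct_correct[OF this] show "run_output (cc_oracle E) (reconstruct V k) = E \<and>
      (\<forall>S \<in> set (run_queries (cc_oracle E) (reconstruct V k)). S \<subseteq> V) \<and>
      real (length (run_queries (cc_oracle E) (reconstruct V k))) \<le> 46 * real k ^ 3 * ln (real (card V))"
    by (intro conjI)
qed

end
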